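(* Assume that $F_0\in C^{1,1}(\mathbb{R}^m;\mathbb{R})$. Then $f$ is differentiable at every $v\in\mathbb{R}^{|\mathcal G|}$, with $$\nabla f(v)=v-v\odot\alpha_v^2,\qquad\text{where }(\alpha_v,\xi_v)\in\operatorname{argmax}_{\alpha,\xi}\phi(v,\alpha,\xi),$$ that is, $(\nabla f(v))_g=v_g-v_g\|(\alpha_v)_g\|_2^2$ for every $g\in\mathcal G$. Moreover, if $v_g\neq0$ for all $g\in\mathcal G$, then $f$ is strictly differentiable at $v$.
   Context: Let $A\in\mathbb{R}^{m\times n}$, $L\in\mathbb{R}^{p\times n}$, and let $\mathcal G$ be a partition of $\{1,\dots,p\}$ into groups. For $z\in\mathbb{R}^p$ and $g\in\mathcal G$, $z_g$ is the restriction of $z$ to the indices in $g$. For $z\in\mathbb{R}^p$ and $v\in\mathbb{R}^{|\mathcal G|}$ (indexed by groups), $v\odot z=z\odot v:=(v_gz_g)_{g\in\mathcal G}\in\mathbb{R}^p$. For $\alpha\in\mathbb{R}^p$, the expression $v\odot\alpha^2$ in a gradient with respect to $v$ denotes the vector $(v_g\|\alpha_g\|_2^2)_{g\in\mathcal G}\in\mathbb{R}^{|\mathcal G|}$ (it is $(v_i\alpha_i^2)_i$ when all groups have size one). $F_0:\mathbb{R}^m\to[0,\infty]$ is a proper, lower semicontinuous, convex function, with convex conjugate $F_0^*$. $C^{1,1}(\mathbb{R}^m;\mathbb{R})$ is the set of real-valued differentiable functions with Lipschitz continuous gradient. Define $$G(u,v)=\min_{x\in\mathbb{R}^n}\Big\{\tfrac12\|u\|_2^2+\tfrac12\|v\|_2^2+F_0(Ax)\;:\;Lx=u\odot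 v\Big\},\qquad u\in\mathbb{R}^p,\ v\in\mathbb{R}^{|\mathcal G|}$$ (the minimum being understood as an infimum, equal to $+\infty$ if the constraint is infeasible). The function $f$ is $$f(v)=\min_{u\in\mathbb{R}^p}G(u,v)=\max_{\xi\in\mathbb{R}^m,\alpha\in\mathbb{R}^p}\tfrac12\|v\|^2+\phi(v,\alpha,\xi),\qquad \phi(v,\alpha,\xi)=-\tfrac12\|v\odot\alpha\|^2-F_0^*(\xi)-\iota_K(\xi,\alpha),$$ where $\iota_K$ is the indicator function ($0$ on $K$, $+\infty$ outside) of $K=\{(\xi,\alpha): L^\top\alpha=-A^\top\xi\}$. A function $f$ is strictly differentiable at $\bar x$ if $f(\bar x)$ is finite and there is a vector $w$ (the gradient) such that $\frac{f(x')-f(x)-\langle w,x'-x\rangle}{\|x'-x\|}\to0$ as $x,x'\to\bar x$ with $x'\ne x$. *)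

theory Defs
  imports "HOL-Analysis.Analysis"
begin

(* A partition of the index type 'p whose blocks are labelled bijectively by the type 'g,
   so that vectors indexed by the blocks have type real ^ 'g. *)
definition indexed_partition :: "('g \<Rightarrow> 'p set) \<Rightarrow> bool" where
  "indexed_partition P \<longleftrightarrow> inj P \<and> partition_on UNIV (range P)"

definition block_of :: "('g \<Rightarrow> 'p set) \<Rightarrow> 'p \<Rightarrow> 'g" where
  "block_of P i = (THE g. i \<in> P g)"

definition odot :: "('g \<Rightarrow> 'p set) \<Rightarrow> real ^ 'g::finite \<Rightarrow> real ^ 'p::finite \<Rightarrow> real ^ 'p" where
  "odot P v z = (\<chi> i. v $ block_of P i * z $ i)"

(* L2_set over the block P g is the Euclidean norm of the restriction of \<alpha> to that block. *)
definition odot_sq :: "('g \<Rightarrow> 'p set) \<Rightarrow> real ^ 'g::finite \<Rightarrow> real ^ 'p::finite \<Rightarrow> real ^ 'g" where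
  "odot_sq P v \<alpha> = (\<chi> g. v $ g * (L2_set (\<lambda>i. \<alpha> $ i) (P g))\<^sup>2)"

definition proper_fun :: "('a \<Rightarrow> ereal) \<Rightarrow> bool" where
  "proper_fun F \<longleftrightarrow> (\<forall>x. F x \<noteq> -\<infinity>) \<and> (\<exists>x. F x \<noteq> \<infinity>)"

definition lsc_fun :: "('a::topological_space \<Rightarrow> ereal) \<Rightarrow> bool" where
  "lsc_fun F \<longleftrightarrow> (\<forall>x. F x \<le> Liminf (at x) F)"

(* Intended for functions that do not take the value -\<infinity>, so that the sum on the right is
   never of the form \<infinity> - \<infinity>. *)
definition convex_fun :: "('a::real_vector \<Rightarrow> ereal) \<Rightarrow> bool" where
  "convex_fun F \<longleftrightarrow>
     (\<forall>x y t. 0 \<le> t \<and> t \<le> 1 \<longrightarrow>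
        F ((1 - t) *\<^sub>R x + t *\<^sub>R y) \<le> ereal (1 - t) * F x + ereal t * F y)"

definition convex_conjugate :: "('a::real_inner \<Rightarrow> ereal) \<Rightarrow> 'a \<Rightarrow> ereal" where
  "convex_conjugate F \<xi> = (SUP x. ereal (\<xi> \<bullet> x) - F x)"

definition convex_indicator :: "'a set \<Rightarrow> 'a \<Rightarrow> ereal" where
  "convex_indicator K z = (if z \<in> K then 0 else \<infinity>)"

definition C11 :: "('a::real_inner \<Rightarrow> real) set" where
  "C11 = {h. \<exists>h'. (\<forall>x. GDERIV h x :> h' x) \<and> (\<exists>C. C-lipschitz_on UNIV h')}"

definition has_gradient_at :: "('a::real_inner \<Rightarrow> ereal) \<Rightarrow> 'a \<Rightarrow> 'a \<Rightarrow> bool" where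
  "has_gradient_at F w x \<longleftrightarrow>
     (\<forall>\<^sub>F y in nhds x. \<bar>F y\<bar> \<noteq> \<infinity>) \<and> (GDERIV (\<lambda>y. real_of_ereal (F y)) x :> w)"

(* In ereal, \<infinity> - \<infinity> = \<infinity>, so the limit below fails
   unless F is finite in a neighbourhood of x. *)
definition strictly_differentiable_at :: "('a::real_inner \<Rightarrow> ereal) \<Rightarrow> 'a \<Rightarrow> bool" where
  "strictly_differentiable_at F x \<longleftrightarrow>
     \<bar>F x\<bar> \<noteq> \<infinity> \<and>
     (\<exists>w. ((\<lambda>(y, y'). (F y' - F y - ereal (w \<bullet> (y' - y))) / ereal (norm (y' - y))) \<longlongrightarrow> 0)
            (at (x, x) within {(y, y'). y' \<noteq> y}))"

(* The infimum over the empty set is \<infinity>, which covers an infeasible constraint. *)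
definition Gfun :: "real ^ 'n::finite ^ 'm::finite \<Rightarrow> real ^ 'n ^ 'p::finite \<Rightarrow> ('g::finite \<Rightarrow> 'p set) \<Rightarrow>
    (real ^ 'm \<Rightarrow> ereal) \<Rightarrow> real ^ 'p \<Rightarrow> real ^ 'g \<Rightarrow> ereal" where
  "Gfun A L P F0 u v =
     (INF x \<in> {x. L *v x = odot P v u}.
        ereal ((norm u)\<^sup>2 / 2) + ereal ((norm v)\<^sup>2 / 2) + F0 (A *v x))"

definition ffun :: "real ^ 'n::finite ^ 'm::finite \<Rightarrow> real ^ 'n ^ 'p::finite \<Rightarrow> ('g::finite \<Rightarrow> 'p set) \<Rightarrow>
    (real ^ 'm \<Rightarrow> ereal) \<Rightarrow> real ^ 'g \<Rightarrow> ereal" where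
  "ffun A L P F0 v = (INF u. Gfun A L P F0 u v)"

definition Kset :: "real ^ 'n::finite ^ 'm::finite \<Rightarrow> real ^ 'n ^ 'p::finite \<Rightarrow>
    ((real ^ 'm) \<times> (real ^ 'p)) set" where
  "Kset A L = {(\<xi>, \<alpha>). transpose L *v \<alpha> = - (transpose A *v \<xi>)}"

definition phi :: "real ^ 'n::finite ^ 'm::finite \<Rightarrow> real ^ 'n ^ 'p::finite \<Rightarrow> ('g::finite \<Rightarrow> 'p set) \<Rightarrow>
    (real ^ 'm \<Rightarrow> ereal) \<Rightarrow> real ^ 'g \<Rightarrow> real ^ 'p \<Rightarrow> real ^ 'm \<Rightarrow> ereal" where
  "phi A L P F0 v \<alpha> \<xi> =
     - ereal ((norm (odot P v \<alpha>))\<^sup>2 / 2) - convex_conjugate F0 \<xi> - convex_indicator (Kset A L) (\<xi>, \<alpha>)"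

definition argmax_phi :: "real ^ 'n::finite ^ 'm::finite \<Rightarrow> real ^ 'n ^ 'p::finite \<Rightarrow> ('g::finite \<Rightarrow> 'p set) \<Rightarrow>
    (real ^ 'm \<Rightarrow> ereal) \<Rightarrow> real ^ 'g \<Rightarrow> ((real ^ 'p) \<times> (real ^ 'm)) set" where
  "argmax_phi A L P F0 v = {z. is_arg_max (\<lambda>(\<alpha>, \<xi>). phi A L P F0 v \<alpha> \<xi>) (\<lambda>_. True) z}"

end

theory Submission
  imports Defs
begin

text \<open>
  Write \<open>f v = \<parallel>v\<parallel>\<^sup>2/2 + H v\<close>, where \<open>H v\<close> is the infimum of
  \<open>\<parallel>u\<parallel>\<^sup>2/2 + h (A x)\<close> over the pairs \<open>(u, x)\<close> with \<open>L x = v \<odot> u\<close>. Since \<open>h\<close> is finite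
  and convex, a separating hyperplane gives strong duality with a maximiser: \<open>H v\<close> is the maximum
  of \<open>\<phi> v\<close> (\<open>dual_attained\<close>). A maximiser \<open>(\<alpha>, \<xi>)\<close> controls \<open>f\<close> from both sides.

  From below, \<open>(\<alpha>, \<xi>)\<close> remains admissible in the dual problem at any \<open>v'\<close>, and \<open>\<phi>\<close> depends on
  \<open>v'\<close> only through the squares \<open>v'\<^sub>g\<^sup>2\<close>, affinely. Hence
  \<open>f v' \<ge> f v + \<Sum>\<^sub>g c\<^sub>g (v'\<^sub>g\<^sup>2 - v\<^sub>g\<^sup>2)\<close> with \<open>c\<^sub>g = (1 - \<parallel>\<alpha>\<^sub>g\<parallel>\<^sup>2)/2\<close>: as a function of the
  squared coordinates, \<open>f\<close> has the subgradient \<open>c\<close> (\<open>f_lower_bound\<close>).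

  From above, a primal pair \<open>(u, x)\<close> for \<open>v\<close> becomes one for any \<open>v'\<close> close to \<open>v\<close>
  by rescaling each block \<open>u\<^sub>g\<close> by
  \<open>v\<^sub>g/v'\<^sub>g\<close>, with the same \<open>x\<close>; a block with \<open>v\<^sub>g = 0\<close> is replaced by zero. A primal minimiser
  in \<open>x\<close> may fail to exist, but by \<open>duality_gap\<close> the \<open>u\<close>-part of every minimising sequence
  converges to \<open>v \<odot> \<alpha>\<close>, which is enough to pass to the limit (\<open>inner_value_upper_bound\<close>).

  The two bounds are smooth near \<open>v\<close> and agree with \<open>f\<close> at \<open>v\<close>, and both have the gradient
  \<open>v\<^sub>g - v\<^sub>g \<parallel>\<alpha>\<^sub>g\<parallel>\<^sup>2\<close> there; so \<open>f\<close> is differentiable at \<open>v\<close> with this gradient. When no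
  \<open>v\<^sub>g\<close> vanishes, the squared coordinates are a smooth chart around \<open>v\<close>, and the claim becomes the
  fact that a differentiable convex function has continuous subgradients and is thus strictly
  differentiable (\<open>strictly_differentiable_if_square_subgradient\<close>).
\<close>

section \<open>Convex duality over a subspace\<close>

text \<open>
  A sandwich form of the Hahn-Banach theorem, the source of strong duality below: \<open>S \<times> {M}\<close> lies
  below the strict epigraph of \<open>\<psi>\<close>, and the affine function of a separating hyperplane is constant
  on the subspace \<open>S\<close> because it is bounded there.
\<close>
lemma convex_minorant_orthogonal_to_subspace:
  fixes \<psi> :: "'a::euclidean_space \<Rightarrow> real"
  assumes conv: "convex_on UNIV \<psi>" and S: "subspace S" and M: "\<And>s. s \<in> S \<Longrightarrow> M \<le> \<psi> s"
  obtains \<eta> where "\<And>s. s \<in> S \<Longrightarrow> \<eta> \<bullet> s = 0" and "\<And>s. M + \<eta> \<bullet> s \<le> \<psi> s"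
proof -
  let ?E = "{z::'a \<times> real. \<psi> (fst z) < snd z}"
  have "convex ?E"
  proof (rule convexI)
    fix z w :: "'a \<times> real" and a b :: real
    assume *: "z \<in> ?E" "w \<in> ?E" "0 \<le> a" "0 \<le> b" "a + b = 1"
    have "\<psi> (a *\<^sub>R fst z + b *\<^sub>R fst w) \<le> a * \<psi> (fst z) + b * \<psi> (fst w)"
      using conv * unfolding convex_on_def by auto
    also have "\<dots> < a * snd z + b * snd w"
    proof (cases "a = 0")
      case True
      then show ?thesis using * by simp
    next
      case False
      then have "a * \<psi> (fst z) < a * snd z" using * by simp
      moreover have "b * \<psi> (fst w) \<le> b * snd w" using * by (simp add: mult_left_mono)
      ultimately show ?thesis by linarith
    qed
    finally show "a *\<^sub>R z + b *\<^sub>R w \<in> ?E" by simp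
  qed
  moreover have "convex (S \<times> {M})"
    by (simp add: S convex_Times subspace_imp_convex)
  moreover have "(S \<times> {M}) \<inter> ?E = {}"
    using M by (fastforce simp: not_less)
  moreover have "S \<times> {M} \<noteq> {}" using S subspace_0 by auto
  moreover have "(0, \<psi> 0 + 1) \<in> ?E" by simp
  hence "?E \<noteq> {}" by blast
  ultimately obtain a b where a: "a \<noteq> 0" "\<forall>x\<in>S \<times> {M}. a \<bullet> x \<le> b" "\<forall>x\<in>?E. a \<bullet> x \<ge> b"
    using separating_hyperplane_sets[of "S \<times> {M}" ?E] by metis
  obtain p \<tau> where p: "a = (p, \<tau>)" by (cases a)
  have up: "p \<bullet> s + \<tau> * M \<le> b" if "s \<in> S" for s
    using a(2) that p by (auto simp: inner_prod_def)
  have lo: "b \<le> p \<bullet> s + \<tau> * t" if "\<psi> s < t" for s t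
    using a(3)[rule_format, of "(s, t)"] that p by (auto simp: inner_prod_def)
  have orth: "p \<bullet> s = 0" if s: "s \<in> S" for s
  proof (rule ccontr)
    assume n: "p \<bullet> s \<noteq> 0"
    have "((b - \<tau> * M + 1) / (p \<bullet> s)) *\<^sub>R s \<in> S"
      using S s by (simp add: subspace_scale)
    (* This multiple of s violates the upper bound b by exactly 1. *)
    from up[OF this] n show False by simp
  qed
  have "\<tau> \<ge> 0"
  proof (rule ccontr)
    assume n: "\<not> \<tau> \<ge> 0"
    let ?t = "max (\<psi> 0 + 1) ((b - 1) / \<tau>)"
    have "b \<le> \<tau> * ?t" using lo[of 0 ?t] by simp
    also have "\<dots> \<le> \<tau> * ((b - 1) / \<tau>)"
      by (rule mult_left_mono_neg) (use n in auto)
    finally show False using n by simp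
  qed
  (* A vertical hyperplane would bound a nonzero linear functional below on the whole space. *)
  moreover have "\<tau> \<noteq> 0"
  proof
    assume t0: "\<tau> = 0"
    with a(1) p have "p \<noteq> 0" by (auto simp: zero_prod_def)
    have "b \<le> p \<bullet> s" for s using lo[of s "\<psi> s + 1"] t0 by simp
    from this[of "((b - 1) / (p \<bullet> p)) *\<^sub>R p"] \<open>p \<noteq> 0\<close> show False by simp
  qed
  ultimately have \<tau>: "\<tau> > 0" by simp
  have "\<tau> * M \<le> p \<bullet> s + \<tau> * \<psi> s" for s
  proof (rule field_le_epsilon)
    fix e :: real assume "e > 0"
    have "\<tau> * M \<le> b" using up[OF subspace_0[OF S]] by simp
    also have "b \<le> p \<bullet> s + \<tau> * (\<psi> s + e / \<tau>)"
      by (rule lo) (use \<open>e > 0\<close> \<tau> in auto)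
    finally show "\<tau> * M \<le> p \<bullet> s + \<tau> * \<psi> s + e" using \<tau> by (simp add: algebra_simps)
  qed
  then have "M + ((- 1 / \<tau>) *\<^sub>R p) \<bullet> s \<le> \<psi> s" for s
    using \<tau> by (simp add: field_simps)
  with orth show thesis by (intro that[of "(- 1 / \<tau>) *\<^sub>R p"]) auto
qed

lemma convex_on_half_norm_square:
  "convex_on UNIV (\<lambda>u::'a::real_inner. (norm u)\<^sup>2 / 2)"
proof (rule convex_onI)
  fix t :: real and x y :: 'a
  assume t: "0 < t" "t < 1"
  have "(1 - t) * (norm x)\<^sup>2 + t * (norm y)\<^sup>2 - (norm ((1 - t) *\<^sub>R x + t *\<^sub>R y))\<^sup>2
      = t * (1 - t) * (norm (x - y))\<^sup>2"
    unfolding power2_norm_eq_inner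
    by (simp add: inner_diff_left inner_diff_right inner_add_left inner_add_right inner_commute
        algebra_simps power2_eq_square)
  moreover have "\<dots> \<ge> 0" using t by simp
  ultimately show "(norm ((1 - t) *\<^sub>R x + t *\<^sub>R y))\<^sup>2 / 2
      \<le> (1 - t) * ((norm x)\<^sup>2 / 2) + t * ((norm y)\<^sup>2 / 2)" by linarith
qed simp

section \<open>Gradients of squeezed and of separable functions\<close>

lemma GDERIV_squeeze:
  fixes f :: "'a::real_inner \<Rightarrow> real"
  assumes l: "GDERIV l x :> D" and u: "GDERIV u x :> D"
    and lx: "l x = f x" and ux: "u x = f x"
    and ev: "\<forall>\<^sub>F y in nhds x. l y \<le> f y \<and> f y \<le> u y"
  shows "GDERIV f x :> D"
proof -
  let ?q = "\<lambda>k y. (k y - k x - (y - x) \<bullet> D) /\<^sub>R norm (y - x)"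
  have bl: "bounded_linear (\<lambda>h. h \<bullet> D)" by (rule bounded_linear_inner_left)
  have "(?q l \<longlongrightarrow> 0) (at x)" "(?q u \<longlongrightarrow> 0) (at x)"
    using l u by (auto simp: gderiv_def has_derivative_at_within)
  moreover have "\<forall>\<^sub>F y in at x. ?q l y \<le> ?q f y" "\<forall>\<^sub>F y in at x. ?q f y \<le> ?q u y"
    using ev lx ux
    by (auto simp: eventually_at_filter intro!: mult_left_mono elim!: eventually_mono)
  ultimately have "(?q f \<longlongrightarrow> 0) (at x)" by (rule tendsto_sandwich[rotated 2])
  then show ?thesis using bl by (simp add: gderiv_def has_derivative_at_within)
qed

lemma GDERIV_separable:
  fixes d :: "real ^ 'g::finite"
  assumes "\<And>g. (k g has_real_derivative d $ g) (at (v $ g))"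
  shows "GDERIV (\<lambda>y. \<Sum>g\<in>UNIV. k g (y $ g)) v :> d"
proof -
  have "((\<lambda>y. k g (y $ g)) has_derivative (\<lambda>h. d $ g * (h $ g))) (at v)" for g
    using has_derivative_compose[OF bounded_linear_imp_has_derivative[OF bounded_linear_vec_nth[of g], of "at v"]
        assms[of g, unfolded has_field_derivative_def]]
    by simp
  then have "((\<lambda>y. \<Sum>g\<in>UNIV. k g (y $ g)) has_derivative (\<lambda>h. \<Sum>g\<in>UNIV. d $ g * (h $ g))) (at v)"
    by (rule has_derivative_sum)
  then show ?thesis by (simp add: gderiv_def inner_vec_def mult.commute)
qed

section \<open>Strict differentiability of functions convex in the squared coordinates\<close>

text \<open>
  The hypothesis \<open>sub\<close> makes \<open>c y\<close> a subgradient at \<open>y\<close> of \<open>r\<close> regarded as a function of the squared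
  coordinates. Moving \<open>y\<close> along the \<open>g\<close>-th axis bounds \<open>c y $ g\<close> by a difference quotient of \<open>r\<close>
  with respect to \<open>(y $ g)\<^sup>2\<close>: from above if the square grows, from below if it shrinks. For a fixed
  step these quotients are continuous in \<open>y\<close>, and at \<open>y = v\<close> they tend, as the step shrinks, to the
  partial derivative \<open>w $ g / (2 * v $ g)\<close>. So \<open>c y $ g\<close> is caught between numbers
  arbitrarily close to this value.
\<close>
lemma square_subgradient_tendsto:
  fixes r :: "real ^ 'g::finite \<Rightarrow> real" and c :: "real ^ 'g \<Rightarrow> real ^ 'g"
  assumes sub: "\<And>y y'. r y + (\<Sum>g\<in>UNIV. c y $ g * ((y' $ g)\<^sup>2 - (y $ g)\<^sup>2)) \<le> r y'"
    and cont: "\<And>y. isCont r y"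
    and der: "GDERIV r v :> w"
    and nz: "v $ g \<noteq> 0"
  shows "((\<lambda>y. c y $ g) \<longlongrightarrow> w $ g / (2 * v $ g)) (nhds v)"
proof -
  (* Scaling the step by v $ g makes the square grow for s > 0 and shrink for -1 < s < 0,
     whatever the sign of v $ g. *)
  define d where "d s = axis g (s * v $ g)" for s
  define den where "den y s = (y $ g + s * v $ g)\<^sup>2 - (y $ g)\<^sup>2" for y :: "real ^ 'g" and s
  have step: "c y $ g * den y s \<le> r (y + d s) - r y" for y s
  proof -
    have "(\<Sum>k\<in>UNIV. c y $ k * (((y + d s) $ k)\<^sup>2 - (y $ k)\<^sup>2))
        = (\<Sum>k\<in>UNIV. if k = g then c y $ g * den y s else 0)"
      by (rule sum.cong) (auto simp: d_def den_def axis_def)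
    then show ?thesis using sub[of y "y + d s"] by simp
  qed
  have den_v: "den v s = (v $ g)\<^sup>2 * (s * (2 + s))" for s
    by (simp add: den_def power2_eq_square algebra_simps)
  have lim_s: "((\<lambda>s. (r (v + d s) - r v) / den v s) \<longlongrightarrow> w $ g / (2 * v $ g)) (at 0)"
  proof -
    have "((\<lambda>s. v + d s) has_derivative d) (at 0)"
    proof -
      have "d = (\<lambda>s. s *\<^sub>R axis g (v $ g))" by (auto simp: d_def axis_def vec_eq_iff)
      then show ?thesis by (auto intro!: derivative_eq_intros)
    qed
    moreover have "d 0 = 0" by (simp add: d_def axis_def vec_eq_iff)
    ultimately have "((\<lambda>s. r (v + d s)) has_derivative (\<lambda>s. d s \<bullet> w)) (at 0)"
      using has_derivative_compose[of "\<lambda>s. v + d s" d 0 UNIV r "\<lambda>h. h \<bullet> w"] der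
      by (simp add: gderiv_def)
    then have "((\<lambda>s. r (v + d s)) has_real_derivative v $ g * w $ g) (at 0)"
      by (rule has_derivative_imp_has_field_derivative) (simp add: d_def inner_axis' mult_ac)
    then have "((\<lambda>s. (r (v + d s) - r v) / s) \<longlongrightarrow> v $ g * w $ g) (at 0)"
      using \<open>d 0 = 0\<close> by (simp add: DERIV_def)
    moreover have "((\<lambda>s::real. (v $ g)\<^sup>2 * (2 + s)) \<longlongrightarrow> (v $ g)\<^sup>2 * (2 + 0)) (at 0)"
      by (intro tendsto_intros)
    ultimately have "((\<lambda>s. (r (v + d s) - r v) / s / ((v $ g)\<^sup>2 * (2 + s)))
        \<longlongrightarrow> v $ g * w $ g / ((v $ g)\<^sup>2 * (2 + 0))) (at 0)"
      by (rule tendsto_divide) (use nz in simp)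
    then show ?thesis using nz by (simp add: den_v power2_eq_square mult_ac)
  qed
  have lim_y: "((\<lambda>y. (r (y + d s) - r y) / den y s) \<longlongrightarrow> (r (v + d s) - r v) / den v s) (nhds v)"
    and lim_den: "((\<lambda>y. den y s) \<longlongrightarrow> den v s) (nhds v)" if "den v s \<noteq> 0" for s
  proof -
    show 1: "((\<lambda>y. den y s) \<longlongrightarrow> den v s) (nhds v)"
      unfolding den_def by (intro tendsto_intros filterlim_ident)
    have "((\<lambda>y. r (y + d s)) \<longlongrightarrow> r (v + d s)) (nhds v)"
      by (rule isCont_tendsto_compose[OF cont]) (intro tendsto_intros filterlim_ident)
    moreover have "(r \<longlongrightarrow> r v) (nhds v)"
      by (rule isCont_tendsto_compose[OF cont filterlim_ident])
    ultimately show "((\<lambda>y. (r (y + d s) - r y) / den y s) \<longlongrightarrow> (r (v + d s) - r v) / den v s) (nhds v)"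
      by (intro tendsto_intros 1 that)
  qed
  show ?thesis
  proof (rule order_tendstoI)
    fix a assume a: "w $ g / (2 * v $ g) < a"
    have "\<forall>\<^sub>F s in at_right 0. (r (v + d s) - r v) / den v s < a"
      using order_tendstoD(2)[OF lim_s a] eventually_at_split by blast
    moreover have "\<forall>\<^sub>F s in at_right (0::real). 0 < s"
      by (simp add: eventually_at_right_less)
    ultimately obtain s where s: "s > 0" "(r (v + d s) - r v) / den v s < a"
      using eventually_happens'[OF trivial_limit_at_right_real[of 0] eventually_conj] by blast
    then have pos: "den v s > 0" using nz by (simp add: den_v)
    have "\<forall>\<^sub>F y in nhds v. 0 < den y s \<and> (r (y + d s) - r y) / den y s < a"
      using order_tendstoD(1)[OF lim_den pos] order_tendstoD(2)[OF lim_y s(2)] pos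
      by (intro eventually_conj) auto
    then show "\<forall>\<^sub>F y in nhds v. c y $ g < a"
    proof (rule eventually_mono)
      fix y assume y: "0 < den y s \<and> (r (y + d s) - r y) / den y s < a"
      then have "c y $ g \<le> (r (y + d s) - r y) / den y s"
        using step[of y s] by (simp add: pos_le_divide_eq)
      with y show "c y $ g < a" by simp
    qed
  next
    fix a assume a: "a < w $ g / (2 * v $ g)"
    have "\<forall>\<^sub>F s in at_left 0. a < (r (v + d s) - r v) / den v s"
      using order_tendstoD(1)[OF lim_s a] eventually_at_split by blast
    moreover have "\<forall>\<^sub>F s in at_left (0::real). s \<in> {-1<..<0}"
      by (rule eventually_at_leftI[of "-1"]) auto
    ultimately obtain s where s: "s \<in> {-1<..<0}" "a < (r (v + d s) - r v) / den v s"
      using eventually_happens'[OF trivial_limit_at_left_real[of 0] eventually_conj] by blast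
    then have neg: "den v s < 0" using nz by (simp add: den_v mult_pos_neg mult_neg_pos)
    have "\<forall>\<^sub>F y in nhds v. den y s < 0 \<and> a < (r (y + d s) - r y) / den y s"
      using order_tendstoD(2)[OF lim_den neg] order_tendstoD(1)[OF lim_y s(2)] neg
      by (intro eventually_conj) auto
    then show "\<forall>\<^sub>F y in nhds v. a < c y $ g"
    proof (rule eventually_mono)
      fix y assume y: "den y s < 0 \<and> a < (r (y + d s) - r y) / den y s"
      then have "(r (y + d s) - r y) / den y s \<le> c y $ g"
        using step[of y s] by (simp add: neg_divide_le_eq)
      with y show "a < c y $ g" by simp
    qed
  qed
qed

text \<open>
  The subgradient inequality, used at \<open>y\<close> and at \<open>y'\<close>, encloses \<open>r y' - r y - w \<bullet> (y' - y)\<close> between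
  multiples of \<open>norm (y' - y)\<close>; factoring \<open>y'\<^sub>g\<^sup>2 - y\<^sub>g\<^sup>2 = (y\<^sub>g + y'\<^sub>g) (y'\<^sub>g - y\<^sub>g)\<close> shows that
  the factors vanish in the limit, since \<open>c\<^sub>g\<close> tends to \<open>w\<^sub>g / (2 v\<^sub>g)\<close>.
\<close>
lemma strictly_differentiable_if_square_subgradient:
  fixes r :: "real ^ 'g::finite \<Rightarrow> real" and c :: "real ^ 'g \<Rightarrow> real ^ 'g"
  assumes sub: "\<And>y y'. r y + (\<Sum>g\<in>UNIV. c y $ g * ((y' $ g)\<^sup>2 - (y $ g)\<^sup>2)) \<le> r y'"
    and cont: "\<And>y. isCont r y"
    and der: "GDERIV r v :> w"
    and nz: "\<And>g. v $ g \<noteq> 0"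
  shows "strictly_differentiable_at (\<lambda>y. ereal (r y)) v"
proof -
  let ?F = "at (v, v) within {(y::real^'g, y'). y' \<noteq> y}"
  define E where "E y z = (\<Sum>g\<in>UNIV. \<bar>c y $ g * (y $ g + z $ g) - w $ g\<bar>)" for y z
  have E_lim: "((\<lambda>p. E (fst p) (snd p)) \<longlongrightarrow> 0) ?F" "((\<lambda>p. E (snd p) (fst p)) \<longlongrightarrow> 0) ?F"
  proof -
    have "((\<lambda>p. E (k p) (k' p)) \<longlongrightarrow> 0) ?F"
      if k: "filterlim k (nhds v) ?F" "filterlim k' (nhds v) ?F" for k k'
    proof -
      have "((\<lambda>p. E (k p) (k' p)) \<longlongrightarrow>
          (\<Sum>g\<in>UNIV. \<bar>w $ g / (2 * v $ g) * (v $ g + v $ g) - w $ g\<bar>)) ?F"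
        unfolding E_def
        by (intro tendsto_intros k filterlim_compose[OF square_subgradient_tendsto[OF sub cont der nz] k(1)])
      moreover have "(\<Sum>g\<in>UNIV. \<bar>w $ g / (2 * v $ g) * (v $ g + v $ g) - w $ g\<bar>) = 0"
        using nz by (simp add: field_simps)
      ultimately show ?thesis by simp
    qed
    moreover have "(fst \<longlongrightarrow> v) ?F" "(snd \<longlongrightarrow> v) ?F"
      using tendsto_fst[OF tendsto_ident_at, of "(v,v)"] tendsto_snd[OF tendsto_ident_at, of "(v,v)"] by auto
    ultimately show "((\<lambda>p. E (fst p) (snd p)) \<longlongrightarrow> 0) ?F" "((\<lambda>p. E (snd p) (fst p)) \<longlongrightarrow> 0) ?F"
      by blast+
  qed
  have low: "r y' - r y - w \<bullet> (y' - y) \<ge> - (E y y' * norm (y' - y))" for y y'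
  proof -
    have "w \<bullet> (y' - y) - (\<Sum>g\<in>UNIV. c y $ g * ((y' $ g)\<^sup>2 - (y $ g)\<^sup>2))
        = (\<Sum>g\<in>UNIV. - ((c y $ g * (y $ g + y' $ g) - w $ g) * ((y' - y) $ g)))"
      unfolding inner_vec_def sum_subtractf[symmetric]
      by (rule sum.cong) (auto simp: power2_eq_square algebra_simps)
    also have "\<dots> \<le> (\<Sum>g\<in>UNIV. \<bar>c y $ g * (y $ g + y' $ g) - w $ g\<bar> * norm (y' - y))"
    proof (rule sum_mono)
      fix g
      let ?a = "c y $ g * (y $ g + y' $ g) - w $ g"
      have "- (?a * ((y' - y) $ g)) \<le> \<bar>?a\<bar> * \<bar>(y' - y) $ g\<bar>"
        by (metis abs_ge_minus_self abs_mult)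
      also have "\<dots> \<le> \<bar>?a\<bar> * norm (y' - y)"
        by (intro mult_left_mono component_le_norm_cart) auto
      finally show "- (?a * ((y' - y) $ g)) \<le> \<bar>?a\<bar> * norm (y' - y)" .
    qed
    also have "\<dots> = E y y' * norm (y' - y)" by (simp add: E_def sum_distrib_right)
    finally show ?thesis using sub[of y y'] by linarith
  qed
  have high: "r y' - r y - w \<bullet> (y' - y) \<le> E y' y * norm (y' - y)" for y y'
    using low[where y = y' and y' = y] by (simp add: inner_diff_right norm_minus_commute)
  let ?q = "\<lambda>p. (r (snd p) - r (fst p) - w \<bullet> (snd p - fst p)) / norm (snd p - fst p)"
  have "(?q \<longlongrightarrow> 0) ?F"
  proof (rule tendsto_sandwich[of "\<lambda>p. - E (fst p) (snd p)" _ _ "\<lambda>p. E (snd p) (fst p)"])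
    have ne: "\<forall>\<^sub>F p in ?F. snd p \<noteq> fst p"
      by (auto simp: eventually_at_filter case_prod_unfold)
    show "\<forall>\<^sub>F p in ?F. - E (fst p) (snd p) \<le> ?q p"
      using ne
    proof (rule eventually_mono)
      fix p :: "(real^'g) \<times> (real^'g)" assume "snd p \<noteq> fst p"
      with low[where y = "fst p" and y' = "snd p"] show "- E (fst p) (snd p) \<le> ?q p" by (simp add: field_simps)
    qed
    show "\<forall>\<^sub>F p in ?F. ?q p \<le> E (snd p) (fst p)"
      using ne
    proof (rule eventually_mono)
      fix p :: "(real^'g) \<times> (real^'g)" assume "snd p \<noteq> fst p"
      with high[where y = "fst p" and y' = "snd p"] show "?q p \<le> E (snd p) (fst p)" by (simp add: field_simps)
    qed
    show "((\<lambda>p. - E (fst p) (snd p)) \<longlongrightarrow> 0) ?F" using tendsto_minus[OF E_lim(1)] by simp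
  qed (rule E_lim(2))
  then have "((\<lambda>p. ereal (?q p)) \<longlongrightarrow> ereal 0) ?F" by simp
  moreover have "\<forall>\<^sub>F p in ?F. ereal (?q p) =
      (\<lambda>(y, y'). (ereal (r y') - ereal (r y) - ereal (w \<bullet> (y' - y))) / ereal (norm (y' - y))) p"
    by (auto simp: eventually_at_filter case_prod_unfold)
  ultimately have "((\<lambda>(y, y'). (ereal (r y') - ereal (r y) - ereal (w \<bullet> (y' - y))) / ereal (norm (y' - y)))
      \<longlongrightarrow> ereal 0) ?F"
    by (rule Lim_transform_eventually)
  then show ?thesis unfolding strictly_differentiable_at_def zero_ereal_def by auto
qed

section \<open>Blockwise scaling\<close>

lemma block_of_eq:
  assumes "indexed_partition P" and "i \<in> P g"
  shows "block_of P i = g"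
  unfolding block_of_def
proof (rule the_equality)
  fix k assume "i \<in> P k"
  with assms have "P k = P g"
    using partition_onD2[of UNIV "range P"]
    by (fastforce simp: indexed_partition_def disjoint_def)
  with assms(1) show "k = g" by (simp add: indexed_partition_def inj_eq)
qed (use assms in simp)

lemma norm_odot_square:
  assumes P: "indexed_partition P"
  shows "(norm (odot P v z))\<^sup>2 = (\<Sum>g\<in>UNIV. (v $ g)\<^sup>2 * (L2_set (\<lambda>i. z $ i) (P g))\<^sup>2)"
proof -
  have U: "UNIV = (\<Union>g. P g)"
    using P partition_onD1 unfolding indexed_partition_def by blast
  have "(norm (odot P v z))\<^sup>2 = (\<Sum>i\<in>(\<Union>g. P g). (v $ block_of P i * z $ i)\<^sup>2)"
    by (simp add: norm_vec_def L2_set_def odot_def sum_nonneg flip: U)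
  also have "\<dots> = (\<Sum>g\<in>UNIV. \<Sum>i\<in>P g. (v $ block_of P i * z $ i)\<^sup>2)"
    by (rule sum.UNION_disjoint) (auto dest: block_of_eq[OF P])
  also have "\<dots> = (\<Sum>g\<in>UNIV. (v $ g)\<^sup>2 * (L2_set (\<lambda>i. z $ i) (P g))\<^sup>2)"
    by (rule sum.cong)
      (auto simp: L2_set_def sum_nonneg sum_distrib_left power_mult_distrib block_of_eq[OF P]
        intro!: sum.cong)
  finally show ?thesis .
qed

lemma linear_odot: "linear (odot P v)"
  by (rule linearI) (simp_all add: odot_def vec_eq_iff algebra_simps)

lemma inner_odot_left: "odot P v z \<bullet> w = z \<bullet> odot P v w"
  by (simp add: odot_def inner_vec_def mult_ac)

lemma odot_odot: "odot P v (odot P w z) = odot P (\<chi> g. v $ g * w $ g) z"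
  by (simp add: odot_def vec_eq_iff mult_ac)

lemma inner_transpose_left: "(transpose M *v z) \<bullet> x = z \<bullet> (M *v x)"
  for M :: "real ^ 'n::finite ^ 'k::finite"
  by (metis dot_lmul_matrix transpose_matrix_vector)

lemma convex_on_if_convex_fun:
  assumes "convex_fun (\<lambda>y. ereal (h y))"
  shows "convex_on UNIV h"
proof (rule convex_onI)
  fix t :: real and x y
  assume "0 < t" "t < 1"
  then show "h ((1 - t) *\<^sub>R x + t *\<^sub>R y) \<le> (1 - t) * h x + t * h y"
    using assms[unfolded convex_fun_def, rule_format, of t x y] by simp
qed simp

section \<open>Strong duality\<close>

text \<open>
  The problem with \<open>F\<^sub>0\<close> replaced by the real function \<open>h\<close>, so that all estimates take place in the
  reals; \<open>ffun_eq\<close> and \<open>le_phi_iff\<close> connect them with the extended-real definitions.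
\<close>
locale partitioned_objective =
  fixes A :: "real ^ 'n::finite ^ 'm::finite"
    and L :: "real ^ 'n ^ 'p::finite"
    and P :: "'g::finite \<Rightarrow> 'p set"
    and h :: "real ^ 'm \<Rightarrow> real"
  assumes partition: "indexed_partition P"
    and nonneg: "\<And>y. 0 \<le> h y"
    and convex: "convex_on UNIV h"
begin

abbreviation F :: "real ^ 'g \<Rightarrow> ereal" where
  "F \<equiv> ffun A L P (\<lambda>y. ereal (h y))"

abbreviation \<Phi> :: "real ^ 'g \<Rightarrow> real ^ 'p \<Rightarrow> real ^ 'm \<Rightarrow> ereal" where
  "\<Phi> \<equiv> phi A L P (\<lambda>y. ereal (h y))"

definition cost :: "real ^ 'p \<Rightarrow> real ^ 'n \<Rightarrow> real" where
  "cost u x = (norm u)\<^sup>2 / 2 + h (A *v x)"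

text \<open>
  The infimum of \<open>cost\<close> over the feasible pairs, that is \<open>H v\<close>: see \<open>inner_value_le\<close> and
  \<open>inner_value_ge\<close>.
\<close>
definition inner_value :: "real ^ 'g \<Rightarrow> real" where
  "inner_value v = real_of_ereal (F v) - (norm v)\<^sup>2 / 2"

lemma ffun_le: "L *v x = odot P v u \<Longrightarrow> F v \<le> ereal ((norm v)\<^sup>2 / 2 + cost u x)"
  unfolding ffun_def Gfun_def cost_def
  by (rule INF_lower2[of u], simp, rule INF_lower2[of x]) (auto simp: add_ac)

lemma ffun_ge:
  assumes "\<And>u x. L *v x = odot P v u \<Longrightarrow> ereal c \<le> ereal ((norm v)\<^sup>2 / 2 + cost u x)"
  shows "ereal c \<le> F v"
  unfolding ffun_def Gfun_def
  by (intro INF_greatest) (use assms in \<open>auto simp: cost_def add_ac\<close>)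

lemma ffun_eq: "F v = ereal ((norm v)\<^sup>2 / 2 + inner_value v)"
proof -
  have "F v \<le> ereal ((norm v)\<^sup>2 / 2 + cost 0 0)"
    by (rule ffun_le) (simp add: odot_def vec_eq_iff)
  moreover have "ereal 0 \<le> F v"
    by (rule ffun_ge) (simp add: cost_def nonneg)
  ultimately have "\<bar>F v\<bar> \<noteq> \<infinity>" by auto
  then show ?thesis by (auto simp: inner_value_def ereal_real)
qed

lemma inner_value_le: "L *v x = odot P v u \<Longrightarrow> inner_value v \<le> cost u x"
  using ffun_le[of x v u] by (simp add: ffun_eq)

lemma inner_value_ge:
  assumes "\<And>u x. L *v x = odot P v u \<Longrightarrow> c \<le> cost u x"
  shows "c \<le> inner_value v"
  using ffun_ge[of v "(norm v)\<^sup>2 / 2 + c"] assms by (simp add: ffun_eq)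

text \<open>
  The inequality \<open>c \<le> \<phi> v \<alpha> \<xi>\<close> with the conjugate and the indicator unfolded; see \<open>le_phi_iff\<close>.
\<close>
definition dual_certificate :: "real ^ 'g \<Rightarrow> real \<Rightarrow> real ^ 'p \<Rightarrow> real ^ 'm \<Rightarrow> bool" where
  "dual_certificate v c \<alpha> \<xi> \<longleftrightarrow>
     (\<xi>, \<alpha>) \<in> Kset A L \<and> (\<forall>y. c + (norm (odot P v \<alpha>))\<^sup>2 / 2 + \<xi> \<bullet> y \<le> h y)"

lemma le_phi_iff: "ereal c \<le> \<Phi> v \<alpha> \<xi> \<longleftrightarrow> dual_certificate v c \<alpha> \<xi>"
proof -
  let ?C = "convex_conjugate (\<lambda>y. ereal (h y)) \<xi>"
  have "ereal (\<xi> \<bullet> 0) - ereal (h 0) \<le> ?C"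
    unfolding convex_conjugate_def by (rule SUP_upper) simp
  then have ninf: "?C \<noteq> - \<infinity>" by auto
  have conj: "?C \<le> ereal b \<longleftrightarrow> (\<forall>y. \<xi> \<bullet> y - h y \<le> b)" for b
    by (simp add: convex_conjugate_def SUP_le_iff)
  show ?thesis
  proof (cases "(\<xi>, \<alpha>) \<in> Kset A L")
    case True
    have "ereal c \<le> \<Phi> v \<alpha> \<xi> \<longleftrightarrow> ?C \<le> ereal (- (norm (odot P v \<alpha>))\<^sup>2 / 2 - c)"
      using ninf True by (cases ?C) (auto simp: phi_def convex_indicator_def)
    also have "\<dots> \<longleftrightarrow> dual_certificate v c \<alpha> \<xi>"
      using True by (auto simp: conj dual_certificate_def algebra_simps)
    finally show ?thesis .
  next
    case False
    then show ?thesis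
      using ninf by (cases ?C) (auto simp: phi_def convex_indicator_def dual_certificate_def)
  qed
qed

text \<open>
  Weak duality. On \<open>K\<close> the cross term \<open>\<xi> \<bullet> (A *v x)\<close> equals \<open>- (odot P v \<alpha> \<bullet> u)\<close>, and the two
  quadratic terms complete the square. Keeping this square is what forces nearly optimal \<open>u\<close> to be
  close to \<open>odot P v \<alpha>\<close>.
\<close>
lemma duality_gap:
  assumes cert: "dual_certificate v c \<alpha> \<xi>" and feas: "L *v x = odot P v u"
  shows "c + (norm (u - odot P v \<alpha>))\<^sup>2 / 2 \<le> cost u x"
proof -
  have "\<xi> \<bullet> (A *v x) = - (odot P v \<alpha> \<bullet> u)"
  proof -
    have "transpose L *v \<alpha> = - (transpose A *v \<xi>)"
      using cert by (simp add: dual_certificate_def Kset_def)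
    then have "\<alpha> \<bullet> (L *v x) = - (\<xi> \<bullet> (A *v x))"
      by (simp flip: inner_transpose_left)
    then show ?thesis by (simp add: feas inner_odot_left)
  qed
  moreover have "c + (norm (odot P v \<alpha>))\<^sup>2 / 2 + \<xi> \<bullet> (A *v x) \<le> h (A *v x)"
    using cert by (simp add: dual_certificate_def)
  moreover have "(norm (u - odot P v \<alpha>))\<^sup>2 = (norm u)\<^sup>2 + (norm (odot P v \<alpha>))\<^sup>2 - 2 * (odot P v \<alpha> \<bullet> u)"
    by (simp add: power2_norm_eq_inner inner_diff inner_commute)
  ultimately show ?thesis unfolding cost_def by linarith
qed

text \<open>
  The objective \<open>\<parallel>u\<parallel>\<^sup>2/2 + h y\<close> is finite and convex in \<open>(u, y)\<close>, and it is minimised over the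
  subspace of pairs \<open>(u, A *v x)\<close> with \<open>L *v x = odot P v u\<close>. An affine minorant \<open>(\<mu>, \<xi>)\<close> whose
  linear part vanishes on this subspace gives the dual maximiser: the orthogonal complement of the
  kernel of \<open>(u, x) \<mapsto> odot P v u - L *v x\<close> is the range of the adjoint, which yields
  \<open>\<alpha>\<close> with \<open>\<mu> = odot P v \<alpha>\<close> and \<open>(\<xi>, \<alpha>) \<in> K\<close>.
\<close>
lemma dual_attained: "\<exists>\<alpha> \<xi>. dual_certificate v (inner_value v) \<alpha> \<xi>"
proof -
  let ?\<psi> = "\<lambda>s :: (real^'p) \<times> (real^'m). (norm (fst s))\<^sup>2 / 2 + h (snd s)"
  let ?N = "{z :: (real^'p) \<times> (real^'n). L *v snd z = odot P v (fst z)}"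
  let ?S = "(\<lambda>z. (fst z, A *v snd z)) ` ?N"
  have conv: "convex_on UNIV ?\<psi>"
  proof (intro convex_on_add)
    show "convex_on UNIV (\<lambda>s :: (real^'p) \<times> (real^'m). (norm (fst s))\<^sup>2 / 2)"
      using convex_on_half_norm_square[where 'a = "real^'p"] by (simp add: convex_on_def)
    show "convex_on UNIV (\<lambda>s :: (real^'p) \<times> (real^'m). h (snd s))"
      using convex by (simp add: convex_on_def)
  qed
  have sub: "subspace ?S"
  proof (rule linear_subspace_image)
    show "linear (\<lambda>z :: (real^'p) \<times> (real^'n). (fst z, A *v snd z))"
      by (rule linearI) (simp_all add: matrix_vector_right_distrib matrix_vector_mult_scaleR)
    show "subspace ?N"
      by (auto simp: subspace_def matrix_vector_right_distrib matrix_vector_mult_scaleR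
          linear_0[OF linear_odot] linear_add[OF linear_odot] linear_cmul[OF linear_odot])
  qed
  have value_le: "inner_value v \<le> ?\<psi> s" if "s \<in> ?S" for s
    using that inner_value_le by (auto simp: cost_def)
  obtain \<eta> where orth: "\<And>s. s \<in> ?S \<Longrightarrow> \<eta> \<bullet> s = 0"
    and minor: "\<And>s. inner_value v + \<eta> \<bullet> s \<le> ?\<psi> s"
    using convex_minorant_orthogonal_to_subspace[OF conv sub value_le] by blast
  obtain \<mu> \<xi> where \<eta>: "\<eta> = (\<mu>, \<xi>)" by (cases \<eta>)
  let ?T = "\<lambda>\<alpha>. (odot P v \<alpha>, - (transpose L *v \<alpha>))"
  have range_T: "subspace (range ?T)"
    by (intro linear_subspace_image linearI)
      (simp_all add: matrix_vector_right_distrib matrix_vector_mult_scaleR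
        linear_add[OF linear_odot] linear_cmul[OF linear_odot])
  obtain y z where y: "y \<in> span (range ?T)" and z: "\<And>w. w \<in> span (range ?T) \<Longrightarrow> orthogonal z w"
    and yz: "(\<mu>, transpose A *v \<xi>) = y + z"
    using orthogonal_subspace_decomp_exists by blast
  obtain \<alpha> where \<alpha>: "y = ?T \<alpha>" using y range_T by (auto simp: span_eq_iff[THEN iffD2])
  have "z = 0"
  proof -
    have "\<beta> \<bullet> (odot P v (fst z) - L *v snd z) = 0" for \<beta>
    proof -
      have "z \<bullet> ?T \<beta> = 0" using z[OF span_base[OF rangeI]] by (simp add: orthogonal_def)
      moreover have "odot P v \<beta> \<bullet> fst z = \<beta> \<bullet> odot P v (fst z)"
        by (rule inner_odot_left)
      moreover have "(transpose L *v \<beta>) \<bullet> snd z = \<beta> \<bullet> (L *v snd z)"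
        by (rule inner_transpose_left)
      ultimately show ?thesis
        by (simp add: inner_prod_def inner_diff_right inner_commute[of "fst z"] inner_commute[of "snd z"])
    qed
    from this[of "odot P v (fst z) - L *v snd z"] have "z \<in> ?N" by simp
    then have "\<eta> \<bullet> (fst z, A *v snd z) = 0" by (intro orth) auto
    then have "(\<mu>, transpose A *v \<xi>) \<bullet> z = 0"
      using inner_transpose_left[of A \<xi> "snd z"] by (simp add: \<eta> inner_prod_def)
    moreover have "y \<bullet> z = 0" using z[OF y] by (simp add: orthogonal_def inner_commute)
    ultimately have "z \<bullet> z = 0" unfolding yz inner_add_left by linarith
    then show ?thesis by simp
  qed
  then have \<mu>: "\<mu> = odot P v \<alpha>" and K: "transpose A *v \<xi> = - (transpose L *v \<alpha>)"
    using yz \<alpha> by simp_all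
  (* At u = \<mu> the difference \<mu> \<bullet> u - (norm u)\<^sup>2 / 2 is largest, with value (norm \<mu>)\<^sup>2 / 2. *)
  have "inner_value v + (norm (odot P v \<alpha>))\<^sup>2 / 2 + \<xi> \<bullet> y \<le> h y" for y
    using minor[of "(\<mu>, y)"] by (simp add: \<eta> \<mu> inner_prod_def flip: power2_norm_eq_inner)
  with K have "dual_certificate v (inner_value v) \<alpha> \<xi>"
    by (simp add: dual_certificate_def Kset_def)
  then show ?thesis by blast
qed

lemma argmax_phi_iff:
  "(\<alpha>, \<xi>) \<in> argmax_phi A L P (\<lambda>y. ereal (h y)) v \<longleftrightarrow> dual_certificate v (inner_value v) \<alpha> \<xi>"
proof -
  have ub: "\<Phi> v \<beta> \<zeta> \<le> ereal (inner_value v)" for \<beta> \<zeta>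
  proof (rule ccontr)
    assume "\<not> ?thesis"
    then obtain c where c: "inner_value v < c" "ereal c < \<Phi> v \<beta> \<zeta>"
      using ereal_dense2[of "ereal (inner_value v)" "\<Phi> v \<beta> \<zeta>"] by (auto simp: not_le)
    then have cert: "dual_certificate v c \<beta> \<zeta>" by (simp flip: le_phi_iff)
    have "c \<le> inner_value v"
    proof (rule inner_value_ge)
      fix u x assume "L *v x = odot P v u"
      from duality_gap[OF cert this] zero_le_power2[of "norm (u - odot P v \<beta>)"]
      show "c \<le> cost u x" by linarith
    qed
    with c show False by simp
  qed
  obtain \<alpha>' \<xi>' where "dual_certificate v (inner_value v) \<alpha>' \<xi>'" using dual_attained by blast
  then have "ereal (inner_value v) \<le> \<Phi> v \<alpha>' \<xi>'" by (simp add: le_phi_iff)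
  then show ?thesis
    unfolding le_phi_iff[symmetric] argmax_phi_def is_arg_max_def
    using ub by (auto simp: not_less) (meson order_trans leD not_le)+
qed

section \<open>Two-sided bounds on the objective\<close>

abbreviation block_energy :: "real ^ 'p \<Rightarrow> 'g \<Rightarrow> real" where
  "block_energy \<alpha> g \<equiv> (L2_set (\<lambda>i. \<alpha> $ i) (P g))\<^sup>2"

lemma inner_value_lower_bound:
  assumes "dual_certificate v (inner_value v) \<alpha> \<xi>"
  shows "inner_value v + (norm (odot P v \<alpha>))\<^sup>2 / 2 - (norm (odot P v' \<alpha>))\<^sup>2 / 2 \<le> inner_value v'"
proof (rule inner_value_ge)
  fix u x assume feas: "L *v x = odot P v' u"
  let ?c = "inner_value v + (norm (odot P v \<alpha>))\<^sup>2 / 2 - (norm (odot P v' \<alpha>))\<^sup>2 / 2"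
  have "dual_certificate v' ?c \<alpha> \<xi>" using assms by (simp add: dual_certificate_def)
  from duality_gap[OF this feas] zero_le_power2[of "norm (u - odot P v' \<alpha>)"]
  show "?c \<le> cost u x" by linarith
qed

text \<open>
  Rescaling the blocks of a minimising sequence for \<open>v\<close>. Division by zero is harmless: where
  \<open>v $ g = 0\<close> the factor \<open>v $ g / v' $ g\<close> is zero for every \<open>v' $ g\<close>, and the constraint at \<open>v\<close> forces
  that block of \<open>L *v x\<close> to vanish.
\<close>
lemma inner_value_upper_bound:
  assumes cert: "dual_certificate v (inner_value v) \<alpha> \<xi>"
    and supp: "\<And>g. v $ g \<noteq> 0 \<Longrightarrow> v' $ g \<noteq> 0"
  shows "inner_value v' \<le> inner_value v - (norm (odot P v \<alpha>))\<^sup>2 / 2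
           + (norm (odot P (\<chi> g. v $ g / v' $ g) (odot P v \<alpha>)))\<^sup>2 / 2"
proof -
  let ?w = "\<chi> g. v $ g / v' $ g"
  have "\<exists>u x. L *v x = odot P v u \<and> cost u x < inner_value v + 1 / real (Suc k)" for k
  proof (rule ccontr)
    assume "\<not> ?thesis"
    then have "inner_value v + 1 / real (Suc k) \<le> inner_value v"
      by (intro inner_value_ge) (meson not_less)
    then show False by simp
  qed
  then obtain u x where feas: "\<And>k. L *v x k = odot P v (u k)"
    and near: "\<And>k. cost (u k) (x k) < inner_value v + 1 / real (Suc k)" by metis
  have null: "(\<lambda>k. 1 / real (Suc k)) \<longlonglongrightarrow> 0"
    using LIMSEQ_inverse_real_of_nat by (simp add: inverse_eq_divide)
  have u: "u \<longlonglongrightarrow> odot P v \<alpha>"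
  proof -
    have "(\<lambda>k. (norm (u k - odot P v \<alpha>))\<^sup>2) \<longlonglongrightarrow> 0"
    proof (rule tendsto_sandwich[of "\<lambda>_. 0" _ _ "\<lambda>k. 2 * (1 / real (Suc k))"])
      have "(norm (u k - odot P v \<alpha>))\<^sup>2 \<le> 2 * (1 / real (Suc k))" for k
        using duality_gap[OF cert feas[of k]] near[of k] by linarith
      then show "\<forall>\<^sub>F k in sequentially. (norm (u k - odot P v \<alpha>))\<^sup>2 \<le> 2 * (1 / real (Suc k))"
        by simp
      show "(\<lambda>k. 2 * (1 / real (Suc k))) \<longlonglongrightarrow> 0"
        using tendsto_mult_right_zero[OF null, of 2] by simp
    qed auto
    from tendsto_real_sqrt[OF this] have "(\<lambda>k. norm (u k - odot P v \<alpha>)) \<longlonglongrightarrow> 0"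
      by simp
    then show ?thesis by (simp add: LIM_zero_iff tendsto_norm_zero_iff)
  qed
  have "inner_value v' \<le> inner_value v + 1 / real (Suc k) - (norm (u k))\<^sup>2 / 2
      + (norm (odot P ?w (u k)))\<^sup>2 / 2" for k
  proof -
    have "L *v x k = odot P v' (odot P ?w (u k))"
      unfolding feas odot_odot using supp
      by (auto simp: odot_def vec_eq_iff)
    then have "inner_value v' \<le> cost (odot P ?w (u k)) (x k)" by (rule inner_value_le)
    with near[of k] show ?thesis by (simp add: cost_def)
  qed
  moreover have "(\<lambda>k. inner_value v + 1 / real (Suc k) - (norm (u k))\<^sup>2 / 2
      + (norm (odot P ?w (u k)))\<^sup>2 / 2) \<longlonglongrightarrow> inner_value v + 0 - (norm (odot P v \<alpha>))\<^sup>2 / 2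
           + (norm (odot P ?w (odot P v \<alpha>)))\<^sup>2 / 2"
    by (intro tendsto_intros null u bounded_linear.tendsto[of "odot P ?w"]
        linear_conv_bounded_linear[THEN iffD1] linear_odot) auto
  ultimately show ?thesis by (intro LIMSEQ_le_const) auto
qed

section \<open>Differentiability\<close>

abbreviation f :: "real ^ 'g \<Rightarrow> real" where
  "f v \<equiv> (norm v)\<^sup>2 / 2 + inner_value v"

lemma half_norm_square_plus:
  fixes v :: "real ^ 'g"
  shows "(norm v)\<^sup>2 / 2 + (\<Sum>g\<in>UNIV. k g) / 2 = (\<Sum>g\<in>UNIV. ((v $ g)\<^sup>2 + k g) / 2)"
  by (simp add: norm_vec_def L2_set_def sum_nonneg sum.distrib flip: sum_divide_distrib add_divide_distrib)

lemma f_lower_bound: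
  assumes "dual_certificate v (inner_value v) \<alpha> \<xi>"
  shows "f v + (\<Sum>g\<in>UNIV. (1 - block_energy \<alpha> g) / 2 * ((v' $ g)\<^sup>2 - (v $ g)\<^sup>2)) \<le> f v'"
proof -
  have "(\<Sum>g\<in>UNIV. (1 - block_energy \<alpha> g) / 2 * ((v' $ g)\<^sup>2 - (v $ g)\<^sup>2))
      = ((norm v')\<^sup>2 / 2 - (norm (odot P v' \<alpha>))\<^sup>2 / 2) - ((norm v)\<^sup>2 / 2 - (norm (odot P v \<alpha>))\<^sup>2 / 2)"
    unfolding norm_odot_square[OF partition]
    by (simp add: norm_vec_def L2_set_def[of _ UNIV] sum_nonneg algebra_simps diff_divide_distrib
        sum.distrib sum_subtractf sum_divide_distrib)
  then show ?thesis using inner_value_lower_bound[OF assms, of v'] by linarith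
qed

text \<open>
  \<open>f\<close> is squeezed between the two bounds, which are sums of functions of one coordinate each. In the
  upper one, a coordinate with \<open>v $ g = 0\<close> contributes only \<open>(y $ g)\<^sup>2 / 2\<close>, so it is differentiable
  there although its formula divides by \<open>(y $ g)\<^sup>2\<close>.
\<close>
lemma gradient_f:
  assumes cert: "dual_certificate v (inner_value v) \<alpha> \<xi>"
  shows "GDERIV f v :> v - odot_sq P v \<alpha>"
proof -
  let ?a = "block_energy \<alpha>"
  define l where "l y = f v + (\<Sum>g\<in>UNIV. (1 - ?a g) / 2 * ((y $ g)\<^sup>2 - (v $ g)\<^sup>2))" for y
  define u where "u y = inner_value v - (norm (odot P v \<alpha>))\<^sup>2 / 2
      + (\<Sum>g\<in>UNIV. ((y $ g)\<^sup>2 + (v $ g)^4 * ?a g / (y $ g)\<^sup>2) / 2)" for y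
  show ?thesis
  proof (rule GDERIV_squeeze)
    show "GDERIV l v :> v - odot_sq P v \<alpha>"
    proof -
      have "GDERIV (\<lambda>y. \<Sum>g\<in>UNIV. (1 - ?a g) / 2 * ((y $ g)\<^sup>2 - (v $ g)\<^sup>2)) v :> v - odot_sq P v \<alpha>"
        by (rule GDERIV_separable) (auto intro!: derivative_eq_intros simp: odot_sq_def field_simps)
      from GDERIV_add[OF GDERIV_const this] show ?thesis unfolding l_def by simp
    qed
    show "GDERIV u v :> v - odot_sq P v \<alpha>"
    proof -
      have "GDERIV (\<lambda>y. \<Sum>g\<in>UNIV. ((y $ g)\<^sup>2 + (v $ g)^4 * ?a g / (y $ g)\<^sup>2) / 2) v :> v - odot_sq P v \<alpha>"
      proof (rule GDERIV_separable)
        fix g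
        show "((\<lambda>t. (t\<^sup>2 + (v $ g)^4 * ?a g / t\<^sup>2) / 2) has_real_derivative (v - odot_sq P v \<alpha>) $ g) (at (v $ g))"
        proof (cases "v $ g = 0")
          case True
          then show ?thesis by (auto intro!: derivative_eq_intros simp: odot_sq_def)
        next
          case False
          then show ?thesis
            by (auto intro!: derivative_eq_intros simp: odot_sq_def field_simps eval_nat_numeral)
        qed
      qed
      from GDERIV_add[OF GDERIV_const this] show ?thesis unfolding u_def by simp
    qed
    show "l v = f v" by (simp add: l_def)
    have u_eq: "u y = (norm y)\<^sup>2 / 2 + (inner_value v - (norm (odot P v \<alpha>))\<^sup>2 / 2
        + (norm (odot P (\<chi> g. v $ g / y $ g) (odot P v \<alpha>)))\<^sup>2 / 2)" for y
      unfolding u_def half_norm_square_plus[symmetric] odot_odot norm_odot_square[OF partition]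
      by (simp add: power_divide power_mult_distrib eval_nat_numeral mult_ac)
    show "u v = f v"
    proof -
      have "odot P (\<chi> g. v $ g / v $ g) (odot P v \<alpha>) = odot P v \<alpha>"
        unfolding odot_odot by (auto simp: odot_def vec_eq_iff)
      then show ?thesis by (simp add: u_eq)
    qed
    have "\<forall>\<^sub>F y in nhds v. \<forall>g. v $ g \<noteq> 0 \<longrightarrow> y $ g \<noteq> 0"
    proof (rule eventually_all_finite)
      fix g
      have "((\<lambda>y. y $ g) \<longlongrightarrow> v $ g) (nhds v)" by (intro tendsto_intros filterlim_ident)
      then show "\<forall>\<^sub>F y in nhds v. v $ g \<noteq> 0 \<longrightarrow> y $ g \<noteq> 0"
        by (cases "v $ g = 0") (auto dest: tendsto_imp_eventually_ne)
    qed
    then show "\<forall>\<^sub>F y in nhds v. l y \<le> f y \<and> f y \<le> u y"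
    proof (rule eventually_mono)
      fix y :: "real ^ 'g" assume "\<forall>g. v $ g \<noteq> 0 \<longrightarrow> y $ g \<noteq> 0"
      then show "l y \<le> f y \<and> f y \<le> u y"
        using f_lower_bound[OF cert, of y] inner_value_upper_bound[OF cert, of y]
        by (simp add: l_def u_eq)
    qed
  qed
qed

lemma strictly_differentiable_ffun:
  assumes nz: "\<And>g. v $ g \<noteq> 0"
  shows "strictly_differentiable_at F v"
proof -
  obtain \<alpha> \<xi> where cert: "\<And>y. dual_certificate y (inner_value y) (\<alpha> y) (\<xi> y)"
    using dual_attained by metis
  have "strictly_differentiable_at (\<lambda>y. ereal (f y)) v"
  proof (rule strictly_differentiable_if_square_subgradient)
    show "f y + (\<Sum>g\<in>UNIV. (\<chi> g. (1 - block_energy (\<alpha> y) g) / 2) $ g * ((y' $ g)\<^sup>2 - (y $ g)\<^sup>2)) \<le> f y'"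
      for y y' using f_lower_bound[OF cert] by simp
    show "isCont f y" for y
      using gradient_f[OF cert] by (auto simp: gderiv_def dest: has_derivative_continuous)
  qed (rule gradient_f[OF cert], rule nz)
  then show ?thesis by (simp add: ffun_eq[abs_def])
qed

end

theorem theorem1:
  fixes A :: "real ^ 'n::finite ^ 'm::finite"
    and L :: "real ^ 'n ^ 'p::finite"
    and P :: "'g::finite \<Rightarrow> 'p set"
    and F0 :: "real ^ 'm \<Rightarrow> ereal"
    and h :: "real ^ 'm \<Rightarrow> real"
  assumes "indexed_partition P"
    and "\<And>y. 0 \<le> F0 y"
    and "proper_fun F0"
    and "lsc_fun F0"
    and "convex_fun F0"
    and "h \<in> C11"
    and "F0 = (\<lambda>y. ereal (h y))"
  shows "(\<forall>v. argmax_phi A L P F0 v \<noteq> {} \<and>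
              (\<forall>(\<alpha>, \<xi>) \<in> argmax_phi A L P F0 v.
                 has_gradient_at (ffun A L P F0) (v - odot_sq P v \<alpha>) v)) \<and>
         (\<forall>v. (\<forall>g. v $ g \<noteq> 0) \<longrightarrow> strictly_differentiable_at (ffun A L P F0) v)"
proof -
  interpret partitioned_objective A L P h
    using assms by unfold_locales (auto intro: convex_on_if_convex_fun)
  have "argmax_phi A L P F0 v \<noteq> {}" for v
    using dual_attained[of v] by (auto simp: assms(7) argmax_phi_iff[symmetric])
  moreover have "has_gradient_at (ffun A L P F0) (v - odot_sq P v \<alpha>) v"
    if "(\<alpha>, \<xi>) \<in> argmax_phi A L P F0 v" for v \<alpha> \<xi>
    using gradient_f that by (simp add: assms(7) argmax_phi_iff has_gradient_at_def ffun_eq)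
  ultimately show ?thesis
    using strictly_differentiable_ffun by (auto simp: assms(7))
qed

end
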